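(* Let $n>3$ be an integer, and let $\mathbf{p}=p_1+ip_2$, $\mathbf{s}=s_1+is_2$ with $p_1,p_2,s_1,s_2\in\mathbb{R}$. Consider the planar differential equation $$\dot z=\mathbf{p}\,z^{n-1}\bar z^{\,n-2}+\mathbf{s}\,z^{n}\bar z^{\,n-1}-\bar z^{\,2n-1},\qquad z\in\mathbb{C},$$ and the quadratic form $$\mathcal{Q}(p_1,p_2)=p_1^2+p_2^2-(p_1s_2-p_2s_1)^2 .$$ Suppose $|s_2|>1$, $s_1\neq 0$ and $\mathbf{p}\neq 0$. If $p_2s_2\ge 0$, then the only equilibrium of the equation is the origin. If $p_2s_2<0$, then the number of equilibria of the equation is determined by $\mathcal{Q}(p_1,p_2)$ and is: (1) exactly one equilibrium (the origin) if $\mathcal{Q}(p_1,p_2)<0$; (2) exactly $2n+1$ equilibria (the origin and one saddle-node per region $(k-1)\pi/n\le\theta<k\pi/n$, $k\in\mathbb{Z}$) if $\mathcal{Q}(p_1,p_2)=0$; (3) exactly $4n+1$ equilibria (the origin and two equilibria in each region $(k-1)\pi/n\le\theta<k\pi/n$, $k\in\mathbb{Z}$) if $\mathcal{Q}(p_1,p_2)>0$.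
   Context: Time $t$ is real and $\dot z=dz/dt$. Here $\theta$ denotes the polar angle (argument) of $z$, so $z=\sqrt r\,(\cos\theta+i\sin\theta)$ with $r=|z|^2$; the regions $(k-1)\pi/n\le\theta<k\pi/n$ are the $2n$ angular sectors of opening $\pi/n$ (angles taken modulo $2\pi$).
   Formalization: In (2), each saddle-node is proved to be a fold point; its second eigenvalue is proved non-zero only if (n-1)p1(s1²+s2²-1) ≠ n s1(p1s1+p2s2). Otherwise it is a nilpotent cusp, not a true saddle-node, e.g. n=4, p=2.4+1.8i, s=-1.8-2.6i. *)

theory Defs
  imports "HOL-Analysis.Analysis"
begin

definition vector_field :: "nat \<Rightarrow> complex \<Rightarrow> complex \<Rightarrow> complex \<Rightarrow> complex" where
  "vector_field n p s z =
     p * z ^ (n - 1) * cnj z ^ (n - 2) + s * z ^ n * cnj z ^ (n - 1) - cnj z ^ (2 * n - 1)"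

definition quadratic_form :: "real \<Rightarrow> real \<Rightarrow> real \<Rightarrow> real \<Rightarrow> real" where
  "quadratic_form s1 s2 p1 p2 = p1\<^sup>2 + p2\<^sup>2 - (p1 * s2 - p2 * s1)\<^sup>2"

definition equilibria :: "(complex \<Rightarrow> complex) \<Rightarrow> complex set" where
  "equilibria F = {z. F z = 0}"

text \<open>The polar angle is undefined at the origin, so the origin lies in no sector.\<close>

definition sector :: "nat \<Rightarrow> int \<Rightarrow> complex set" where
  "sector n k = {z. z \<noteq> 0 \<and>
     (\<exists>\<theta>. is_Arg z \<theta> \<and> (of_int k - 1) * pi / of_nat n \<le> \<theta> \<and> \<theta> < of_int k * pi / of_nat n)}"

text \<open>
  Saddle-node (fold) point of a smooth planar vector field: an equilibrium whose linearization
  \<open>A\<close> has a one-dimensional kernel spanned by \<open>v\<close>, with non-zero quadratic coefficient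
  \<open>w \<bullet> D\<^sup>2F(z)(v, v)\<close>, where \<open>w\<close> spans the orthogonal complement of the range of \<open>A\<close>.
  The coefficient is written as the second derivative at 0 of \<open>t \<mapsto> w \<bullet> F (z + t v)\<close>.
  Only geometric simplicity of the eigenvalue 0 is required. Algebraic simplicity,
  that is, a non-zero second eigenvalue, is the separate predicate \<open>semihyperbolic\<close>; a saddle-node
  in the narrower, semi-hyperbolic sense is a point satisfying both.
\<close>

definition saddle_node :: "(complex \<Rightarrow> complex) \<Rightarrow> complex \<Rightarrow> bool" where
  "saddle_node F z \<longleftrightarrow> F z = 0 \<and>
     (\<exists>A v w. (F has_derivative A) (at z) \<and>
        v \<noteq> 0 \<and> {u. A u = 0} = span {v} \<and>
        w \<noteq> 0 \<and> (\<forall>u. w \<bullet> A u = 0) \<and>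
        (deriv ^^ 2) (\<lambda>t::real. w \<bullet> F (z + t *\<^sub>R v)) 0 \<noteq> 0)"

definition semihyperbolic :: "(complex \<Rightarrow> complex) \<Rightarrow> complex \<Rightarrow> bool" where
  "semihyperbolic F z \<longleftrightarrow> F z = 0 \<and>
     (\<exists>A. (F has_derivative A) (at z) \<and>
        (\<exists>v. v \<noteq> 0 \<and> A v = 0) \<and>
        (\<exists>u \<mu>. u \<noteq> 0 \<and> \<mu> \<noteq> 0 \<and> A u = \<mu> *\<^sub>R u))"

text \<open>
  When \<open>Q(p\<^sub>1, p\<^sub>2) = 0\<close>, the equilibria other than the origin lie on a circle of squared radius
  \<open>r = - (p\<^sub>1 s\<^sub>1 + p\<^sub>2 s\<^sub>2) / (s\<^sub>1\<^sup>2 + s\<^sub>2\<^sup>2 - 1)\<close>, where the trace of the linearization is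
  \<open>2 r\<^sup>n\<^sup>-\<^sup>2 (n s\<^sub>1 r + (n - 1) p\<^sub>1)\<close>. The condition below says that this trace is
  non-zero. It can fail: for \<open>n = 4\<close>, \<open>p = 2.4 + 1.8 i\<close>, \<open>s = - 1.8 - 2.6 i\<close>
  the linearization at each of these equilibria is nilpotent.
\<close>

definition trace_condition :: "nat \<Rightarrow> real \<Rightarrow> real \<Rightarrow> real \<Rightarrow> real \<Rightarrow> bool" where
  "trace_condition n p1 p2 s1 s2 \<longleftrightarrow>
     (of_nat n - 1) * p1 * (s1\<^sup>2 + s2\<^sup>2 - 1) \<noteq> of_nat n * s1 * (p1 * s1 + p2 * s2)"

end

theory Submission
  imports Defs
begin

text \<open>
  For \<open>z \<noteq> 0\<close> put \<open>r = |z|\<^sup>2\<close>. Multiplying the equation \<open>F z = 0\<close> by the conjugate of \<open>z\<close> turns it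
  into \<open>z\<^sup>2\<^sup>n = r\<^sup>n\<^sup>-\<^sup>1 cnj (p + s r)\<close>. Comparing moduli gives \<open>|p + s r| = r\<close>, a quadratic equation in
  \<open>r\<close> whose reduced discriminant is \<open>Q\<close>. Each positive root \<open>r\<close> then contributes \<open>2n\<close> equilibria,
  the \<open>2n\<close>-th roots of a non-zero number, which lie one in each sector. Since \<open>|s\<^sub>2| > 1\<close>, the imaginary
  part of \<open>p + s r\<close> has modulus at most \<open>r\<close> only if \<open>p\<^sub>2\<close> and \<open>s\<^sub>2 r\<close> have opposite signs, so
  real roots are positive exactly when \<open>p\<^sub>2 s\<^sub>2 < 0\<close>. If \<open>Q = 0\<close>, then writing a displacement from an
  equilibrium as \<open>h = z k\<close> makes the linearization and the fold coefficient explicit.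
\<close>

subsection \<open>The radii of the equilibria\<close>

definition radii :: "complex \<Rightarrow> complex \<Rightarrow> real set" where
  "radii p s = {r. r > 0 \<and> cmod (p + s * of_real r) = r}"

lemma radii_iff:
  "r \<in> radii (Complex p1 p2) (Complex s1 s2) \<longleftrightarrow>
    r > 0 \<and> (s1\<^sup>2 + s2\<^sup>2 - 1) * r\<^sup>2 + 2 * (p1 * s1 + p2 * s2) * r + (p1\<^sup>2 + p2\<^sup>2) = 0"
proof -
  have "cmod (Complex p1 p2 + Complex s1 s2 * of_real r) = r \<longleftrightarrow>
      (cmod (Complex p1 p2 + Complex s1 s2 * of_real r))\<^sup>2 = r\<^sup>2" if "r > 0"
    using that by (auto simp: power2_eq_iff_nonneg)
  also have "(cmod (Complex p1 p2 + Complex s1 s2 * of_real r))\<^sup>2 = r\<^sup>2 \<longleftrightarrow>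
      (s1\<^sup>2 + s2\<^sup>2 - 1) * r\<^sup>2 + 2 * (p1 * s1 + p2 * s2) * r + (p1\<^sup>2 + p2\<^sup>2) = 0"
    unfolding cmod_power2 by (simp add: power2_eq_square algebra_simps)
  finally show ?thesis
    by (auto simp: radii_def)
qed

lemma radii_imp_neg:
  assumes "r \<in> radii (Complex p1 p2) (Complex s1 s2)" "\<bar>s2\<bar> > 1"
  shows "p2 * s2 < 0"
proof -
  have r: "r > 0" "cmod (Complex p1 p2 + Complex s1 s2 * of_real r) = r"
    using assms(1) by (auto simp: radii_def)
  have "\<bar>p2 + s2 * r\<bar> \<le> r"
    using abs_Im_le_cmod [of "Complex p1 p2 + Complex s1 s2 * of_real r"] r by simp
  moreover have "\<bar>s2 * r\<bar> > r"
    using assms r by (simp add: abs_mult)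
  ultimately have "p2 > 0 \<and> s2 * r < 0 \<or> p2 < 0 \<and> s2 * r > 0"
    by linarith
  then show ?thesis
    using r by (auto simp: mult_less_0_iff zero_less_mult_iff)
qed

text \<open>Complete the square in the quadratic of \<open>radii_iff\<close> after multiplying it by
  its leading coefficient. By Lagrange's identity for (p1, p2) and (s1, s2), the reduced
  discriminant is exactly \<open>quadratic_form s1 s2 p1 p2\<close>.\<close>

lemma radii_discriminant:
  assumes "r \<in> radii (Complex p1 p2) (Complex s1 s2)"
  shows "((s1\<^sup>2 + s2\<^sup>2 - 1) * r + (p1 * s1 + p2 * s2))\<^sup>2 = quadratic_form s1 s2 p1 p2"
proof -
  have "(s1\<^sup>2 + s2\<^sup>2 - 1) * r\<^sup>2 + 2 * (p1 * s1 + p2 * s2) * r + (p1\<^sup>2 + p2\<^sup>2) = 0"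
    using assms by (simp add: radii_iff)
  then show ?thesis
    unfolding quadratic_form_def by algebra
qed

lemma radii_eq:
  assumes "\<bar>s2\<bar> > 1" "p2 * s2 < 0" "quadratic_form s1 s2 p1 p2 \<ge> 0"
  defines "K \<equiv> s1\<^sup>2 + s2\<^sup>2 - 1" and "D \<equiv> p1 * s1 + p2 * s2" and "q \<equiv> sqrt (quadratic_form s1 s2 p1 p2)"
  shows "radii (Complex p1 p2) (Complex s1 s2) = {(- D - q) / K, (- D + q) / K}"
proof -
  have s2: "s2\<^sup>2 > 1"
    using assms(1) by (metis one_less_power pos2 power2_abs)
  then have K: "K > 0"
    unfolding K_def using zero_le_power2 [of s1] by linarith
  define P where "P = p1\<^sup>2 + p2\<^sup>2"
  have P: "P > 0"
    using assms(2) by (auto simp: P_def sum_power2_gt_zero_iff)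
  have q: "q \<ge> 0" "q\<^sup>2 = D\<^sup>2 - K * P"
    using assms(3) by (auto simp: q_def K_def P_def D_def quadratic_form_def algebra_simps power2_eq_square)
  have quad: "K * (K * r\<^sup>2 + 2 * D * r + P) = (K * r + D + q) * (K * r + D - q)" for r
    using q(2) by algebra
  \<comment> \<open>The roots have positive product P / K, so only their common sign is in question.
    If D were nonnegative, minus a root would be a radius for -p in place of p, and
    \<open>radii_imp_neg\<close> would give p2 * s2 the wrong sign.\<close>
  have "D < 0"
  proof (rule ccontr)
    assume "\<not> D < 0"
    moreover have "q\<^sup>2 < D\<^sup>2"
      using q K P by simp
    ultimately have "q < D"
      using power2_less_imp_less by fastforce
    define r where "r = (D - q) / K"
    have r: "r > 0"
      using K \<open>q < D\<close> by (simp add: r_def)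
    have "K * (K * (- r)\<^sup>2 + 2 * D * (- r) + P) = 0"
      unfolding quad using K by (simp add: r_def)
    then have "K * r\<^sup>2 + 2 * (- D) * r + P = 0"
      using K by simp
    then have "r \<in> radii (Complex (- p1) (- p2)) (Complex s1 s2)"
      using r by (simp add: radii_iff K_def D_def P_def)
    from radii_imp_neg [OF this assms(1)] assms(2) show False
      by simp
  qed
  moreover have "q\<^sup>2 < (- D)\<^sup>2"
    using q K P by simp
  ultimately have "q < - D"
    using power2_less_imp_less by fastforce
  then have pos: "(- D - q) / K > 0" "(- D + q) / K > 0"
    using K q by (simp_all add: divide_simps)
  have "K * r\<^sup>2 + 2 * D * r + P = 0 \<longleftrightarrow> r = (- D - q) / K \<or> r = (- D + q) / K" for r
  proof -
    have "K * r\<^sup>2 + 2 * D * r + P = 0 \<longleftrightarrow> (K * r + D + q) * (K * r + D - q) = 0"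
      unfolding quad [symmetric] using K by simp
    also have "\<dots> \<longleftrightarrow> r = (- D - q) / K \<or> r = (- D + q) / K"
      unfolding mult_eq_0_iff using K by (auto simp: divide_simps mult.commute)
    finally show ?thesis .
  qed
  moreover have "r \<in> radii (Complex p1 p2) (Complex s1 s2) \<longleftrightarrow> r > 0 \<and> K * r\<^sup>2 + 2 * D * r + P = 0" for r
    by (simp only: radii_iff K_def D_def P_def)
  ultimately show ?thesis
    using pos by (intro set_eqI) (metis empty_iff insert_iff)
qed

subsection \<open>The equilibria on a circle\<close>

lemma vector_field_eq_0_iff:
  assumes "z \<noteq> 0" "n \<ge> 2"
  shows "vector_field n p s z = 0 \<longleftrightarrow>
    z ^ (2 * n) = of_real ((cmod z)\<^sup>2) ^ (n - 1) * cnj (p + s * of_real ((cmod z)\<^sup>2))"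
proof -
  \<comment> \<open>The substitution removes the truncated subtractions in the exponents.\<close>
  obtain m where n: "n = m + 2"
    using assms(2) by (metis add.commute le_Suc_ex)
  have r: "of_real ((cmod z)\<^sup>2) = z * cnj z"
    by (rule complex_norm_square)
  have "vector_field n p s z * cnj z
      = (z * cnj z) ^ (n - 1) * (p + s * (z * cnj z)) - cnj z ^ (2 * n)"
    unfolding vector_field_def n by (simp add: algebra_simps power_mult_distrib)
  moreover have "vector_field n p s z = 0 \<longleftrightarrow> vector_field n p s z * cnj z = 0"
    using assms(1) by simp
  ultimately have "vector_field n p s z = 0 \<longleftrightarrow>
      cnj z ^ (2 * n) = (z * cnj z) ^ (n - 1) * (p + s * (z * cnj z))"
    by (simp only: right_minus_eq) (rule eq_commute)
  \<comment> \<open>Conjugation trades the power of \<open>cnj z\<close> for one of z, so that for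
    fixed modulus the solutions are plain 2n-th roots.\<close>
  also have "\<dots> \<longleftrightarrow> cnj (cnj z ^ (2 * n)) = cnj ((z * cnj z) ^ (n - 1) * (p + s * (z * cnj z)))"
    by (rule complex_cnj_cancel_iff [symmetric])
  finally show ?thesis
    unfolding r by (simp add: mult.commute)
qed

text \<open>For r in \<open>radii p s\<close> these are the equilibria with squared modulus r. The
  modulus is not imposed, so that the set consists of all 2n-th roots of one number;
  \<open>fibre_norm\<close> recovers it.\<close>

definition fibre :: "nat \<Rightarrow> complex \<Rightarrow> complex \<Rightarrow> real \<Rightarrow> complex set" where
  "fibre n p s r = {z. z ^ (2 * n) = of_real r ^ (n - 1) * cnj (p + s * of_real r)}"

text \<open>Moduli in the root equation give |z|^(2n) = r^(n-1) |p + s r| = r^n, and n-th roots of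
  nonnegative reals are unique.\<close>

lemma fibre_norm:
  assumes "r \<in> radii p s" "z \<in> fibre n p s r" "n > 0"
  shows "(cmod z)\<^sup>2 = r"
proof -
  have r: "r > 0" "cmod (p + s * of_real r) = r"
    and eq: "z ^ (2 * n) = of_real r ^ (n - 1) * cnj (p + s * of_real r)"
    using assms by (auto simp: radii_def fibre_def)
  have "((cmod z)\<^sup>2) ^ n = cmod (z ^ (2 * n))"
    by (simp only: norm_power power_mult)
  also have "\<dots> = r ^ (n - 1) * r"
    unfolding eq using r by (simp only: norm_mult norm_power complex_mod_cnj norm_of_real abs_of_pos)
  also have "\<dots> = r ^ n"
    using assms by (cases n) auto
  finally show ?thesis
    by (rule power_eq_imp_eq_base) (use r(1) assms(3) in simp_all)
qed

lemma equilibria_eq: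
  assumes "n \<ge> 2"
  shows "equilibria (vector_field n p s) = insert 0 (\<Union>r \<in> radii p s. fibre n p s r)"
proof (intro equalityI subsetI)
  fix z assume z: "z \<in> equilibria (vector_field n p s)"
  show "z \<in> insert 0 (\<Union>r \<in> radii p s. fibre n p s r)"
  proof (cases "z = 0")
    case False
    define r where "r = (cmod z)\<^sup>2"
    have r: "r > 0"
      using False by (simp add: r_def)
    have eq: "z ^ (2 * n) = of_real r ^ (n - 1) * cnj (p + s * of_real r)"
      using vector_field_eq_0_iff [OF False assms] z by (simp add: r_def equilibria_def)
    have "r ^ (n - 1) * r = r ^ n"
      using assms by (cases n) auto
    also have "\<dots> = cmod (z ^ (2 * n))"
      by (simp only: norm_power r_def power_mult)
    also have "\<dots> = r ^ (n - 1) * cmod (p + s * of_real r)"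
      unfolding eq using r by (simp only: norm_mult norm_power complex_mod_cnj norm_of_real abs_of_pos)
    finally have "cmod (p + s * of_real r) = r"
      using r by simp
    with r eq show ?thesis
      by (auto simp: radii_def fibre_def)
  qed simp
next
  fix z assume "z \<in> insert 0 (\<Union>r \<in> radii p s. fibre n p s r)"
  then consider "z = 0" | r where "r \<in> radii p s" "z \<in> fibre n p s r"
    by blast
  then show "z \<in> equilibria (vector_field n p s)"
  proof cases
    case 1
    then show ?thesis
      using assms by (simp add: equilibria_def vector_field_def power_0_left)
  next
    case 2
    then have rz: "(cmod z)\<^sup>2 = r"
      using fibre_norm assms by simp
    then have "z \<noteq> 0"
      using 2 by (auto simp: radii_def)
    then show ?thesis
      using vector_field_eq_0_iff [OF _ assms, of z p s, unfolded rz] 2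
      by (simp add: equilibria_def fibre_def)
  qed
qed

text \<open>The arguments of the 2n-th roots of c form an arithmetic progression with step pi/n.
  This is the width of a sector, and a half-open interval of that width contains exactly one
  term.\<close>

lemma ex1_root_in_sector:
  assumes "c \<noteq> 0" "n > 0"
  shows "\<exists>!z. z \<in> {z. z ^ (2 * n) = c} \<inter> sector n k"
proof -
  define t where "t = Arg c / (2 * pi)"
  \<comment> \<open>The root with index j has argument (t + j) pi / n; this j is the integer that
    puts t + j into [k - 1, k).\<close>
  define j where "j = k - 1 - \<lfloor>t\<rfloor>"
  define \<theta> where "\<theta> = (t + of_int j) * pi / n"
  define \<rho> where "\<rho> = root (2 * n) (cmod c)"
  define z where "z = of_real \<rho> * exp (\<i> * of_real \<theta>)"
  have \<rho>: "\<rho> > 0" "\<rho> ^ (2 * n) = cmod c"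
    using assms by (auto simp: \<rho>_def real_root_gt_zero)
  have "exp (\<i> * of_real \<theta>) ^ (2 * n) = exp (of_nat (2 * n) * (\<i> * of_real \<theta>))"
    by (rule exp_of_nat_mult [symmetric])
  also have "of_nat (2 * n) * (\<i> * of_real \<theta>) = \<i> * of_real (Arg c) + \<i> * (of_int j * (of_real pi * 2))"
    using assms by (simp add: \<theta>_def t_def field_simps)
  also have "exp \<dots> = exp (\<i> * of_real (Arg c))"
    by (rule exp_plus_2pin)
  finally have 1: "z ^ (2 * n) = c"
    using \<rho>(2) Arg_eq [OF assms(1)]
    by (metis of_real_power power_mult_distrib z_def)
  have "cmod z = \<rho>"
    using \<rho> by (simp add: z_def norm_mult)
  then have 2: "is_Arg z \<theta>" "z \<noteq> 0"
    using \<rho> by (auto simp: is_Arg_def z_def)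
  have j: "of_int k - 1 \<le> t + of_int j" "t + of_int j < of_int k"
    unfolding j_def by (simp_all; linarith)+
  have 3: "(of_int k - 1) * pi / n \<le> \<theta>" "\<theta> < of_int k * pi / n"
    using j assms unfolding \<theta>_def
    by (auto intro!: divide_right_mono divide_strict_right_mono mult_right_mono mult_strict_right_mono)
  have "z \<in> {z. z ^ (2 * n) = c} \<inter> sector n k"
    using 1 2 3 by (auto simp: sector_def)
  moreover have "x = y" if "x \<in> {z. z ^ (2 * n) = c} \<inter> sector n k" "y \<in> {z. z ^ (2 * n) = c} \<inter> sector n k" for x y
  proof -
    from that obtain a b where
      xy: "x \<noteq> 0" "y \<noteq> 0" "x ^ (2 * n) = c" "y ^ (2 * n) = c"
      and ab: "is_Arg x a" "is_Arg y b"
      and a: "(of_int k - 1) * pi / n \<le> a" "a < of_int k * pi / n"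
      and b: "(of_int k - 1) * pi / n \<le> b" "b < of_int k * pi / n"
      by (auto simp: sector_def)
    have "cmod x ^ (2 * n) = cmod y ^ (2 * n)"
      using xy by (metis norm_power)
    then have nrm: "cmod x = cmod y"
      using assms power_eq_imp_eq_base [of "cmod x" "2 * n" "cmod y"] by simp
    have pow: "w ^ (2 * n) = of_real (cmod w) ^ (2 * n) * exp (\<i> * of_real t) ^ (2 * n)" if "is_Arg w t" for w t
      unfolding power_mult_distrib [symmetric] using that unfolding is_Arg_def by (rule arg_cong)
    have "of_real (cmod y) ^ (2 * n) * exp (\<i> * of_real a) ^ (2 * n) =
        of_real (cmod y) ^ (2 * n) * exp (\<i> * of_real b) ^ (2 * n)"
      using pow [OF ab(1)] pow [OF ab(2)] xy(3,4) nrm by simp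
    then have "exp (\<i> * of_real a) ^ (2 * n) = exp (\<i> * of_real b) ^ (2 * n)"
      using xy(2) by simp
    then have "exp (of_nat (2 * n) * (\<i> * of_real a)) = exp (of_nat (2 * n) * (\<i> * of_real b))"
      by (simp only: exp_of_nat_mult)
    then obtain m :: int where
      "of_nat (2 * n) * (\<i> * of_real a) = of_nat (2 * n) * (\<i> * of_real b) + of_int (2 * m) * pi * \<i>"
      by (auto simp: exp_eq)
    then have "Im (of_nat (2 * n) * (\<i> * of_real a)) = Im (of_nat (2 * n) * (\<i> * of_real b) + of_int (2 * m) * pi * \<i>)"
      by simp
    \<comment> \<open>Arguments of two roots differ by a multiple of pi/n, while two points of the
      half-open sector differ by less than pi/n; hence m = 0.\<close>
    then have m: "n * (a - b) = of_int m * pi"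
      by (simp add: algebra_simps)
    have "n * a < of_int k * pi" "n * b < of_int k * pi"
      "(of_int k - 1) * pi \<le> n * a" "(of_int k - 1) * pi \<le> n * b"
      using a b assms by (simp_all add: field_simps)
    then have "\<bar>n * (a - b)\<bar> < 1 * pi"
      by (auto simp: algebra_simps abs_less_iff)
    then have "\<bar>real_of_int m\<bar> < 1"
      unfolding m using pi_gt_zero by (simp add: abs_mult)
    then have "m = 0" by linarith
    with m assms have "a = b" by simp
    then show ?thesis
      using ab nrm unfolding is_Arg_def by metis
  qed
  ultimately show ?thesis by blast
qed

subsection \<open>Linearization and fold coefficient at an equilibrium\<close>

text \<open>The equilibrium equation replaces the power of \<open>cnj z\<close> by r^(n-2) z (p + s
  r), after which z factors out. In the coordinate q the equilibrium sits at 1, and z enters the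
  bracket only through r.\<close>

lemma vector_field_mult:
  assumes "n \<ge> 2" "z \<noteq> 0" "vector_field n p s z = 0"
  defines "r \<equiv> of_real ((cmod z)\<^sup>2)"
  shows "vector_field n p s (z * q) = r ^ (n - 2) * z *
    (p * (q ^ (n - 1) * cnj q ^ (n - 2)) + s * r * (q ^ n * cnj q ^ (n - 1))
      - (p + s * r) * cnj q ^ (2 * n - 1))"
proof -
  obtain m where n: "n = m + 2"
    using assms(1) by (metis add.commute le_Suc_ex)
  have r: "r = z * cnj z"
    unfolding r_def by (rule complex_norm_square)
  have "cnj z ^ (2 * n - 1) = r ^ (n - 2) * z * (p + s * r)"
    using assms(3) unfolding vector_field_def r n
    by (simp add: algebra_simps power_mult_distrib)
  then have "cnj (z * q) ^ (2 * n - 1) = r ^ (n - 2) * z * (p + s * r) * cnj q ^ (2 * n - 1)"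
    by (simp add: power_mult_distrib)
  then show ?thesis
    unfolding vector_field_def by (simp add: r n algebra_simps power_mult_distrib)
qed

lemma has_derivative_power_cnj_at_1:
  "((\<lambda>q. q ^ a * cnj q ^ b) has_derivative (\<lambda>k. of_nat a * k + of_nat b * cnj k)) (at 1)"
  by (auto intro!: derivative_eq_intros)

text \<open>
  The relation \<open>\<i> (p + s r) = c p\<close> says that \<open>p + s r\<close> is orthogonal to \<open>p\<close>, which is what
  a double root \<open>r\<close> of the quadratic equation for the radii amounts to.
\<close>

lemma has_derivative_vector_field:
  assumes "n \<ge> 2" "z \<noteq> 0" "vector_field n p s z = 0"
    and c: "\<i> * (p + s * of_real ((cmod z)\<^sup>2)) = of_real c * p"
  shows "(vector_field n p s has_derivative
    (\<lambda>h. of_real (2 * ((cmod z)\<^sup>2) ^ (n - 2)) * (z * p) *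
      of_real (n * c * Im (h / z) - Re (h / z)))) (at z)"
proof -
  define r where "r = complex_of_real ((cmod z)\<^sup>2)"
  \<comment> \<open>The factor \<open>q ^ 0\<close> gives the last term the shape required by
    \<open>has_derivative_power_cnj_at_1\<close>.\<close>
  define N where "N q = p * (q ^ (n - 1) * cnj q ^ (n - 2)) + s * r * (q ^ n * cnj q ^ (n - 1))
      - (p + s * r) * (q ^ 0 * cnj q ^ (2 * n - 1))" for q
  have F: "vector_field n p s = (\<lambda>y. r ^ (n - 2) * z * N (y / z))"
  proof
    fix y
    show "vector_field n p s y = r ^ (n - 2) * z * N (y / z)"
      using vector_field_mult [OF assms(1-3), of "y / z"] assms(2) by (simp add: N_def r_def)
  qed
  have "p + s * r = - (\<i> * (\<i> * (p + s * r)))"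
    by simp
  also have "\<dots> = - \<i> * of_real c * p"
    unfolding r_def c by simp
  finally have c': "p + s * r = - \<i> * of_real c * p" .
  have "(N has_derivative (\<lambda>k. p * (of_nat (n - 1) * k + of_nat (n - 2) * cnj k)
      + s * r * (of_nat n * k + of_nat (n - 1) * cnj k)
      - (p + s * r) * (of_nat 0 * k + of_nat (2 * n - 1) * cnj k))) (at 1)"
    unfolding N_def
    by (intro has_derivative_add has_derivative_diff has_derivative_mult_right has_derivative_power_cnj_at_1)
  also have "(\<lambda>k. p * (of_nat (n - 1) * k + of_nat (n - 2) * cnj k)
      + s * r * (of_nat n * k + of_nat (n - 1) * cnj k)
      - (p + s * r) * (of_nat 0 * k + of_nat (2 * n - 1) * cnj k))
      = (\<lambda>k. 2 * p * of_real (n * c * Im k - Re k))"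
  proof
    fix k
    have n: "of_nat (n - 1) = (of_nat n - 1 :: complex)" "of_nat (n - 2) = (of_nat n - 2 :: complex)"
      "of_nat (2 * n - 1) = (2 * of_nat n - 1 :: complex)"
      using assms(1) by (simp_all add: of_nat_diff)
    \<comment> \<open>Since p + s r = -i c p and k - cnj k is imaginary, both terms of the regrouped
      sum are real multiples of p. The linearization therefore has rank one, with range the real
      line through z p.\<close>
    have "p * (of_nat (n - 1) * k + of_nat (n - 2) * cnj k)
      + s * r * (of_nat n * k + of_nat (n - 1) * cnj k)
      - (p + s * r) * (of_nat 0 * k + of_nat (2 * n - 1) * cnj k)
      = of_nat n * (p + s * r) * (k - cnj k) - p * (k + cnj k)"
      unfolding n by (simp add: algebra_simps)
    also have "k - cnj k = 2 * \<i> * of_real (Im k)"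
      by (simp add: complex_diff_cnj)
    also have "k + cnj k = 2 * of_real (Re k)"
      by (simp add: complex_add_cnj)
    finally show "p * (of_nat (n - 1) * k + of_nat (n - 2) * cnj k)
      + s * r * (of_nat n * k + of_nat (n - 1) * cnj k)
      - (p + s * r) * (of_nat 0 * k + of_nat (2 * n - 1) * cnj k)
      = 2 * p * of_real (n * c * Im k - Re k)"
      unfolding c' by (simp add: algebra_simps)
  qed
  \<comment> \<open>The base point 1 is written as z / z so that the chain rule applies to y / z at
    z.\<close>
  finally have N: "(N has_derivative (\<lambda>k. 2 * p * of_real (n * c * Im k - Re k))) (at (z / z))"
    using assms(2) by simp
  have "((\<lambda>y. y / z) has_derivative (\<lambda>h. h / z)) (at z)"
    using assms(2) by (auto intro!: derivative_eq_intros)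
  from has_derivative_compose [OF this N]
  have "((\<lambda>y. r ^ (n - 2) * z * N (y / z)) has_derivative
    (\<lambda>h. r ^ (n - 2) * z * (2 * p * of_real (n * c * Im (h / z) - Re (h / z))))) (at z)"
    by (rule has_derivative_mult_right)
  then show ?thesis
    unfolding F by (simp add: r_def algebra_simps)
qed

text \<open>Taking imaginary parts commutes with differentiation along the real axis, so a second
  derivative in a real parameter can be computed with complex derivatives.\<close>

lemma deriv_deriv_Im:
  assumes "\<And>x. (g has_field_derivative g' x) (at x)" "(g' has_field_derivative d) (at 0)"
  shows "(deriv ^^ 2) (\<lambda>t. Im (g (of_real t))) 0 = Im d"
proof -
  have Im: "((\<lambda>t. Im (h (of_real t))) has_real_derivative Im h') (at x)"
    if "(h has_field_derivative h') (at (of_real x))" for h h' x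
    using has_vector_derivative_real_field [OF that]
    by (rule has_field_derivative_Im)
  have "deriv (\<lambda>t. Im (g (of_real t))) = (\<lambda>t. Im (g' (of_real t)))"
    using Im [OF assms(1)] by (intro ext DERIV_imp_deriv)
  moreover have "deriv (\<lambda>t. Im (g' (of_real t))) 0 = Im d"
    using Im [of g' d 0] assms(2) by (intro DERIV_imp_deriv) simp
  ultimately show ?thesis
    by (simp add: numeral_2_eq_2)
qed

lemma has_field_derivative_power_mult_power:
  fixes x y t :: complex
  shows "((\<lambda>t. (1 + t * x) ^ a * (1 + t * y) ^ b) has_field_derivative
    of_nat a * x * ((1 + t * x) ^ (a - 1) * (1 + t * y) ^ b) +
    of_nat b * y * ((1 + t * x) ^ a * (1 + t * y) ^ (b - 1))) (at t)"
  by (auto intro!: derivative_eq_intros simp: algebra_simps)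

text \<open>The vector i u is u turned by a right angle, so pairing with it extracts the imaginary
  part of the coordinate relative to u.\<close>

lemma inner_i_mult: "(\<i> * u) \<bullet> (u * x) = (cmod u)\<^sup>2 * Im x"
  unfolding cmod_power2 by (simp add: inner_complex_def power2_eq_square algebra_simps)

text \<open>Here v spans the kernel of the linearization and i z p is orthogonal to its range. Along
  z + t v = z (1 + t x) with t real, conjugation only replaces x by y, so the field is a polynomial
  in t. It extends to complex t and is differentiated twice there.\<close>

lemma fold_coefficient:
  assumes "n \<ge> 2" "z \<noteq> 0" "vector_field n p s z = 0"
    and c: "\<i> * (p + s * of_real ((cmod z)\<^sup>2)) = of_real c * p"
  defines "v \<equiv> z * Complex (n * c) 1"
  shows "(deriv ^^ 2) (\<lambda>t::real. (\<i> * (z * p)) \<bullet> vector_field n p s (z + t *\<^sub>R v)) 0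
    = - 4 * (cmod (z * p))\<^sup>2 * ((cmod z)\<^sup>2) ^ (n - 2) * n\<^sup>2 * c"
proof -
  define r where "r = complex_of_real ((cmod z)\<^sup>2)"
  define x where "x = Complex (n * c) 1"
  define y where "y = Complex (n * c) (- 1)"
  define M where "M a b t = (1 + t * x) ^ a * (1 + t * y) ^ b" for a b t
  define C where "C = complex_of_real ((cmod (z * p))\<^sup>2) * r ^ (n - 2)"
  \<comment> \<open>The hypothesis on c reads p + s r = -e p, so dividing the bracket of
    \<open>vector_field_mult\<close> by p leaves the coefficients 1, -(1 + e) and e.\<close>
  define e where "e = \<i> * complex_of_real c"
  define g where "g t = C * (M (n - 1) (n - 2) t - (1 + e) * M n (n - 1) t + e * M 0 (2 * n - 1) t)" for t
  define M' where "M' a b t = of_nat a * x * M (a - 1) b t + of_nat b * y * M a (b - 1) t" for a b t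
  define g' where "g' t = C * (M' (n - 1) (n - 2) t - (1 + e) * M' n (n - 1) t + e * M' 0 (2 * n - 1) t)" for t
  define d where "d a b = of_nat a * x * M' (a - 1) b 0 + of_nat b * y * M' a (b - 1) 0" for a b
  have M: "(M a b has_field_derivative M' a b t) (at t)" for a b t
    unfolding M_def M'_def by (rule has_field_derivative_power_mult_power)
  have M': "(M' a b has_field_derivative d a b) (at 0)" for a b
    unfolding M'_def [of a b, abs_def] d_def by (intro DERIV_add DERIV_cmult M)
  have g: "(g has_field_derivative g' t) (at t)" for t
    unfolding g_def [abs_def] g'_def by (intro DERIV_add DERIV_diff DERIV_cmult M)
  have g': "(g' has_field_derivative C * (d (n - 1) (n - 2) - (1 + e) * d n (n - 1) + e * d 0 (2 * n - 1))) (at 0)"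
    unfolding g'_def [abs_def] by (intro DERIV_add DERIV_diff DERIV_cmult M')
  have "p + s * r = - (\<i> * (\<i> * (p + s * r)))"
    by simp
  also have "\<dots> = - e * p"
    unfolding r_def c e_def by simp
  finally have "s * r = - e * p - p"
    by (metis add_diff_cancel_left')
  then have sr: "s * r = - p - e * p"
    by simp
  have Im: "Im (of_real k * w) = k * Im w" for k w
    by simp
  have "(\<i> * (z * p)) \<bullet> vector_field n p s (z + t *\<^sub>R v) = Im (g (of_real t))" for t
  proof -
    have "z + t *\<^sub>R v = z * (1 + of_real t * x)"
      by (simp add: v_def x_def scaleR_conv_of_real algebra_simps)
    moreover have "cnj x = y"
      by (simp add: x_def y_def complex_eq_iff)
    ultimately have "vector_field n p s (z + t *\<^sub>R v) = r ^ (n - 2) * z *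
        (p * M (n - 1) (n - 2) t + s * r * M n (n - 1) t - (p + s * r) * M 0 (2 * n - 1) t)"
      using vector_field_mult [OF assms(1-3), of "1 + of_real t * x"]
      by (simp add: r_def M_def)
    also have "\<dots> = (z * p) * (r ^ (n - 2) *
        (M (n - 1) (n - 2) t - (1 + e) * M n (n - 1) t + e * M 0 (2 * n - 1) t))"
      unfolding sr by (simp add: algebra_simps)
    finally have eq: "vector_field n p s (z + t *\<^sub>R v) = (z * p) * (r ^ (n - 2) *
        (M (n - 1) (n - 2) t - (1 + e) * M n (n - 1) t + e * M 0 (2 * n - 1) t))" .
    show ?thesis
      unfolding eq inner_i_mult unfolding g_def C_def mult.assoc Im by (rule refl)
  qed
  then have "(deriv ^^ 2) (\<lambda>t::real. (\<i> * (z * p)) \<bullet> vector_field n p s (z + t *\<^sub>R v)) 0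
      = Im (C * (d (n - 1) (n - 2) - (1 + e) * d n (n - 1) + e * d 0 (2 * n - 1)))"
    using deriv_deriv_Im [OF g g'] by simp
  also have "\<dots> = (cmod (z * p))\<^sup>2 * ((cmod z)\<^sup>2) ^ (n - 2) *
      Im (d (n - 1) (n - 2) - (1 + e) * d n (n - 1) + e * d 0 (2 * n - 1))"
  proof -
    have "C = of_real ((cmod (z * p))\<^sup>2 * ((cmod z)\<^sup>2) ^ (n - 2))"
      by (simp add: C_def r_def)
    then show ?thesis
      by (simp only: Im)
  qed
  also have "Im (d (n - 1) (n - 2) - (1 + e) * d n (n - 1) + e * d 0 (2 * n - 1)) = - 4 * n\<^sup>2 * c"
  proof -
    have M0: "M a b 0 = 1" for a b
      by (simp add: M_def)
    obtain m where n: "n = m + 2"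
      using assms(1) by (metis add.commute le_Suc_ex)
    have diffs: "n - 1 = m + 1" "n - 2 = m" "2 * n - 1 = 2 * m + 3" "m + 2 - 1 = m + 1" "m + 1 - 1 = m"
      "2 * m + 3 - 1 = 2 * m + 2"
      by (simp_all add: n)
    \<comment> \<open>At m = 0 the truncated predecessor is harmless because of the factor
      m.\<close>
    have pred: "of_nat m * complex_of_nat (m - 1) = of_nat m * (of_nat m - 1)"
      by (cases m) auto
    have d: "d a b = of_nat a * of_nat (a - 1) * x\<^sup>2 + 2 * of_nat a * of_nat b * (x * y) + of_nat b * of_nat (b - 1) * y\<^sup>2" for a b
      by (simp add: d_def M'_def M0 power2_eq_square algebra_simps)
    define N where "N = real n"
    have N: "complex_of_nat m = of_real (N - 2)" "real m = N - 2"
      by (simp_all add: n N_def)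
    have x2: "x\<^sup>2 = Complex (N\<^sup>2 * c\<^sup>2 - 1) (2 * N * c)" "y\<^sup>2 = Complex (N\<^sup>2 * c\<^sup>2 - 1) (- 2 * N * c)"
       "x * y = Complex (N\<^sup>2 * c\<^sup>2 + 1) 0"
      by (auto simp: x_def y_def N_def complex_eq_iff power2_eq_square algebra_simps)
    have d1: "d (n - 1) (n - 2) = of_real ((N - 1) * (N - 2)) * x\<^sup>2 + of_real (2 * (N - 1) * (N - 2)) * (x * y)
        + of_real ((N - 2) * (N - 3)) * y\<^sup>2"
      unfolding d diffs pred by (simp add: N algebra_simps)
    have d2: "d n (n - 1) = of_real (N * (N - 1)) * x\<^sup>2 + of_real (2 * N * (N - 1)) * (x * y)
        + of_real ((N - 1) * (N - 2)) * y\<^sup>2"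
      unfolding d diffs unfolding n diffs by (simp add: N algebra_simps)
    have d3: "d 0 (2 * n - 1) = of_real ((2 * N - 1) * (2 * N - 2)) * y\<^sup>2"
      unfolding d diffs by (simp add: N algebra_simps)
    show ?thesis
      unfolding d1 d2 d3 x2 e_def
      by (simp add: algebra_simps power2_eq_square N_def)
  qed
  finally show ?thesis
    by (simp add: mult_ac)
qed

text \<open>In the coordinate k = h / z the kernel is the line Re k = n c Im k, spanned by n c + i.
  The fold coefficient along it is a nonzero multiple of c.\<close>

lemma saddle_node_vector_field:
  assumes "n \<ge> 2" "p \<noteq> 0" "z \<noteq> 0" "vector_field n p s z = 0"
    and c: "\<i> * (p + s * of_real ((cmod z)\<^sup>2)) = of_real c * p" "c \<noteq> 0"
  shows "saddle_node (vector_field n p s) z"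
proof -
  define K where "K = 2 * ((cmod z)\<^sup>2) ^ (n - 2)"
  define A where "A h = of_real K * (z * p) * of_real (n * c * Im (h / z) - Re (h / z))" for h
  define v where "v = z * Complex (n * c) 1"
  have n0: "Complex (n * c) 1 \<noteq> 0"
    by (simp add: complex_eq_iff)
  have K: "K > 0"
    using assms(3) by (simp add: K_def)
  have A: "(vector_field n p s has_derivative A) (at z)"
    unfolding A_def [abs_def] K_def by (rule has_derivative_vector_field [OF assms(1,3,4) c(1)])
  have v: "v \<noteq> 0"
    using assms(3) n0 by (simp add: v_def)
  have "A h = 0 \<longleftrightarrow> h \<in> span {v}" for h
  proof -
    have "A h = 0 \<longleftrightarrow> n * c * Im (h / z) - Re (h / z) = 0"
      using assms(2,3) K unfolding A_def mult_eq_0_iff of_real_eq_0_iff by simp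
    also have "\<dots> \<longleftrightarrow> Re (h / z) = n * c * Im (h / z)"
      by linarith
    also have "\<dots> \<longleftrightarrow> (\<exists>t. h / z = t *\<^sub>R Complex (n * c) 1)"
      by (auto simp: complex_eq_iff)
    also have "\<dots> \<longleftrightarrow> (\<exists>t. h = t *\<^sub>R v)"
      using assms(3) by (simp add: v_def field_simps)
    also have "\<dots> \<longleftrightarrow> h \<in> span {v}"
      by (auto simp: span_singleton)
    finally show ?thesis .
  qed
  then have ker: "{u. A u = 0} = span {v}"
    by blast
  have range: "(\<i> * (z * p)) \<bullet> A u = 0" for u
    using inner_i_mult [of "z * p" "of_real (K * (n * c * Im (u / z) - Re (u / z)))"]
    by (simp add: A_def mult_ac)
  have "(deriv ^^ 2) (\<lambda>t::real. (\<i> * (z * p)) \<bullet> vector_field n p s (z + t *\<^sub>R v)) 0 \<noteq> 0"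
    unfolding v_def fold_coefficient [OF assms(1,3,4) c(1)]
    using assms by simp
  moreover have "\<i> * (z * p) \<noteq> 0"
    using assms by simp
  ultimately show ?thesis
    unfolding saddle_node_def using A v ker range assms(4) by blast
qed

text \<open>The range of the linearization is spanned by z p, so z p is an eigenvector. Its
  eigenvalue is the trace, and the imaginary part of the relation for c turns it into a positive
  multiple of the expression in \<open>tr\<close>.\<close>

lemma semihyperbolic_vector_field:
  assumes "n \<ge> 2" "p \<noteq> 0" "z \<noteq> 0" "vector_field n p s z = 0"
    and c: "\<i> * (p + s * of_real ((cmod z)\<^sup>2)) = of_real c * p"
    and tr: "(real n - 1) * Re p + n * Re s * (cmod z)\<^sup>2 \<noteq> 0"
  shows "semihyperbolic (vector_field n p s) z"
proof -
  define K where "K = 2 * ((cmod z)\<^sup>2) ^ (n - 2)"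
  define A where "A h = of_real K * (z * p) * of_real (n * c * Im (h / z) - Re (h / z))" for h
  define v where "v = z * Complex (n * c) 1"
  have n0: "Complex (n * c) 1 \<noteq> 0"
    by (simp add: complex_eq_iff)
  have K: "K > 0"
    using assms(3) by (simp add: K_def)
  have A: "(vector_field n p s has_derivative A) (at z)"
    unfolding A_def [abs_def] K_def by (rule has_derivative_vector_field [OF assms(1,3,4) c(1)])
  have v: "v \<noteq> 0" "A v = 0"
    using assms(3) n0 by (simp_all add: v_def A_def)
  have cp: "c * Im p = Re p + Re s * (cmod z)\<^sup>2"
    using arg_cong [OF c, of Im] by simp
  have "n * c * Im p - Re p = (real n - 1) * Re p + n * Re s * (cmod z)\<^sup>2"
    using cp by algebra
  then have ev: "K * (n * c * Im p - Re p) \<noteq> 0"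
    using tr K by simp
  moreover have "A (z * p) = (K * (n * c * Im p - Re p)) *\<^sub>R (z * p)"
    using assms(3) by (simp add: A_def scaleR_conv_of_real mult_ac)
  moreover have "z * p \<noteq> 0"
    using assms by simp
  ultimately show ?thesis
    unfolding semihyperbolic_def using A v assms(4) by blast
qed

subsection \<open>Counting the equilibria\<close>

lemma fibre_const_nonzero:
  assumes "r \<in> radii p s"
  shows "of_real r ^ (n - 1) * cnj (p + s * of_real r) \<noteq> 0"
proof -
  have "cmod (of_real r ^ (n - 1) * cnj (p + s * of_real r)) = r ^ (n - 1) * r"
    using assms unfolding radii_def norm_mult norm_power complex_mod_cnj by simp
  then show ?thesis
    using assms by (auto simp: radii_def simp del: complex_cnj_add complex_cnj_mult)
qed

lemma card_fibre:
  assumes "r \<in> radii p s" "n > 0"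
  shows "card (fibre n p s r) = 2 * n"
  unfolding fibre_def using fibre_const_nonzero [OF assms(1)] assms(2) by (intro card_nth_roots) auto

lemma fibre_sector:
  assumes "r \<in> radii p s" "n > 0"
  obtains z where "fibre n p s r \<inter> sector n k = {z}"
  using ex1_root_in_sector [OF fibre_const_nonzero [OF assms(1)] assms(2), where k = k]
  unfolding fibre_def by blast

lemma fibre_disjoint:
  assumes "r \<in> radii p s" "r' \<in> radii p s" "r \<noteq> r'" "n > 0"
  shows "fibre n p s r \<inter> fibre n p s r' = {}"
  using fibre_norm [OF assms(1) _ assms(4)] fibre_norm [OF assms(2) _ assms(4)] assms(3) by blast

lemma zero_notin_fibre:
  assumes "r \<in> radii p s" "n > 0"
  shows "0 \<notin> fibre n p s r"
  using fibre_norm [OF assms(1) _ assms(2), of 0] assms(1) by (auto simp: radii_def)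

text \<open>Write K r^2 + 2 D r + P = 0 for the quadratic of the radii. If Q = 0 then K r + D = 0,
  hence D r + P = 0. The left side is the inner product of p and p + s r, so these are orthogonal
  and i (p + s r) is a real multiple of p.\<close>

lemma double_radius:
  assumes r: "r \<in> radii (Complex p1 p2) (Complex s1 s2)"
    and Q: "quadratic_form s1 s2 p1 p2 = 0" and p: "Complex p1 p2 \<noteq> 0"
  obtains c where "\<i> * (Complex p1 p2 + Complex s1 s2 * of_real r) = of_real c * Complex p1 p2" "c \<noteq> 0"
proof
  define a where "a = p1 + s1 * r"
  define b where "b = p2 + s2 * r"
  define P where "P = p1\<^sup>2 + p2\<^sup>2"
  \<comment> \<open>This is the real part of i (p + s r) / p; the imaginary part is (p1 a + p2 b) /
    P, which vanishes by \<open>orth\<close>.\<close>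
  define c where "c = (p2 * a - p1 * b) / P"
  have P: "P \<noteq> 0"
    using p by (auto simp: P_def complex_eq_iff sum_power2_eq_zero_iff)
  have "(s1\<^sup>2 + s2\<^sup>2 - 1) * r\<^sup>2 + 2 * (p1 * s1 + p2 * s2) * r + P = 0"
    using r by (simp add: radii_iff P_def)
  moreover have "(s1\<^sup>2 + s2\<^sup>2 - 1) * r + (p1 * s1 + p2 * s2) = 0"
    using radii_discriminant [OF r] Q by simp
  ultimately have orth: "p1 * a + p2 * b = 0"
    unfolding a_def b_def P_def by algebra
  have "P * (c * p1) = P * - b" "P * (c * p2) = P * a"
  proof -
    have "P * c = p2 * a - p1 * b"
      using P by (simp add: c_def)
    then show "P * (c * p1) = P * - b" "P * (c * p2) = P * a"
      using orth unfolding P_def by algebra+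
  qed
  then have "c * p1 = - b" "c * p2 = a"
    using P by (metis mult_left_cancel)+
  then show eq: "\<i> * (Complex p1 p2 + Complex s1 s2 * of_real r) = of_real c * Complex p1 p2"
    by (simp add: complex_eq_iff a_def b_def)
  \<comment> \<open>If c = 0 then p + s r = 0, but its modulus is r > 0.\<close>
  show "c \<noteq> 0"
    using eq r by (auto simp: radii_def)
qed

theorem theorem1:
  fixes n :: nat and p1 p2 s1 s2 :: real and p s :: complex and F :: "complex \<Rightarrow> complex"
  defines "p \<equiv> Complex p1 p2" and "s \<equiv> Complex s1 s2"
  defines "F \<equiv> vector_field n p s"
  assumes "n > 3" and "\<bar>s2\<bar> > 1" and "s1 \<noteq> 0" and "p \<noteq> 0"
  shows "(p2 * s2 \<ge> 0 \<longrightarrow> equilibria F = {0}) \<and>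
    (p2 * s2 < 0 \<longrightarrow>
      (quadratic_form s1 s2 p1 p2 < 0 \<longrightarrow> equilibria F = {0}) \<and>
      (quadratic_form s1 s2 p1 p2 = 0 \<longrightarrow>
        card (equilibria F) = 2 * n + 1 \<and> 0 \<in> equilibria F \<and>
        (\<forall>k::int. \<exists>z. equilibria F \<inter> sector n k = {z} \<and> saddle_node F z \<and>
          (trace_condition n p1 p2 s1 s2 \<longrightarrow> semihyperbolic F z))) \<and>
      (quadratic_form s1 s2 p1 p2 > 0 \<longrightarrow>
        card (equilibria F) = 4 * n + 1 \<and> 0 \<in> equilibria F \<and>
        (\<forall>k::int. card (equilibria F \<inter> sector n k) = 2)))"
proof (intro conjI impI)
  have n: "n > 0" "n \<ge> 2"
    using assms(4) by simp_all
  have F: "equilibria F = insert 0 (\<Union>r \<in> radii p s. fibre n p s r)"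
    unfolding F_def by (rule equilibria_eq [OF n(2)])
  then show "0 \<in> equilibria F" and "0 \<in> equilibria F"
    by auto
  \<comment> \<open>The origin drops out because \<open>sector\<close> excludes it.\<close>
  have sector: "equilibria F \<inter> sector n k = (\<Union>r \<in> radii p s. fibre n p s r \<inter> sector n k)" for k
    unfolding F by (auto simp: sector_def)
  have fin: "finite (fibre n p s r)" if "r \<in> radii p s" for r
    using card_fibre [OF that n(1)] n(1) by (intro card_ge_0_finite) simp
  {
    assume "p2 * s2 \<ge> 0"
    then have "radii p s = {}"
      using radii_imp_neg assms(5) unfolding p_def s_def by (meson all_not_in_conv not_less)
    then show "equilibria F = {0}"
      by (simp add: F)
  next
    assume Q: "quadratic_form s1 s2 p1 p2 < 0"
    have False if "r \<in> radii p s" for r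
      using radii_discriminant [OF that [unfolded p_def s_def]] Q zero_le_power2 by (metis not_less)
    then show "equilibria F = {0}"
      by (auto simp: F)
  next
    assume neg: "p2 * s2 < 0" and Q: "quadratic_form s1 s2 p1 p2 = 0"
    define r where "r = - (p1 * s1 + p2 * s2) / (s1\<^sup>2 + s2\<^sup>2 - 1)"
    have radii: "radii p s = {r}"
      using radii_eq [OF assms(5) neg] Q by (simp add: p_def s_def r_def)
    then have r: "r \<in> radii p s"
      by simp
    show "card (equilibria F) = 2 * n + 1"
      using card_fibre [OF r n(1)] zero_notin_fibre [OF r n(1)] fin [OF r] by (simp add: F radii)
    obtain c where c: "\<i> * (p + s * of_real r) = of_real c * p" "c \<noteq> 0"
      using double_radius r Q assms(7) unfolding p_def s_def by metis
    show "\<forall>k::int. \<exists>z. equilibria F \<inter> sector n k = {z} \<and> saddle_node F z \<and>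
          (trace_condition n p1 p2 s1 s2 \<longrightarrow> semihyperbolic F z)"
    proof
      fix k :: int
      obtain z where z: "fibre n p s r \<inter> sector n k = {z}"
        using fibre_sector [OF r n(1)] .
      then have zr: "(cmod z)\<^sup>2 = r"
        using fibre_norm [OF r _ n(1)] by blast
      have z0: "z \<noteq> 0" and Fz: "vector_field n p s z = 0"
        using z zero_notin_fibre [OF r n(1)] F r by (auto simp: F_def equilibria_def)
      have "semihyperbolic F z" if "trace_condition n p1 p2 s1 s2"
      proof -
        have "(s1\<^sup>2 + s2\<^sup>2 - 1) * r + (p1 * s1 + p2 * s2) = 0"
          using radii_discriminant [OF r [unfolded p_def s_def]] Q by simp
        \<comment> \<open>Substituting the double root -D / K for r shows that the trace factor,
          scaled by K, is the difference of the two sides of \<open>trace_condition\<close>.\<close>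
        then have "(s1\<^sup>2 + s2\<^sup>2 - 1) * ((real n - 1) * p1 + n * s1 * r) =
          (real n - 1) * p1 * (s1\<^sup>2 + s2\<^sup>2 - 1) - n * s1 * (p1 * s1 + p2 * s2)"
          by algebra
        then have "(real n - 1) * p1 + n * s1 * r \<noteq> 0"
          using that by (auto simp: trace_condition_def)
        then show ?thesis
          unfolding F_def using c(1) assms(7)
          by (intro semihyperbolic_vector_field [OF n(2) _ z0 Fz]) (simp_all add: zr p_def s_def)
      qed
      moreover have "saddle_node F z"
        unfolding F_def using c by (intro saddle_node_vector_field [OF n(2) assms(7) z0 Fz]) (simp_all add: zr)
      ultimately show "\<exists>z. equilibria F \<inter> sector n k = {z} \<and> saddle_node F z \<and>
          (trace_condition n p1 p2 s1 s2 \<longrightarrow> semihyperbolic F z)"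
        using z by (auto simp: sector radii)
    qed
  next
    assume neg: "p2 * s2 < 0" and Q: "quadratic_form s1 s2 p1 p2 > 0"
    define K where "K = s1\<^sup>2 + s2\<^sup>2 - 1"
    define q where "q = sqrt (quadratic_form s1 s2 p1 p2)"
    define r where "r = (- (p1 * s1 + p2 * s2) - q) / K"
    define r' where "r' = (- (p1 * s1 + p2 * s2) + q) / K"
    have radii: "radii p s = {r, r'}"
      using radii_eq [OF assms(5) neg] Q by (simp add: p_def s_def r_def r'_def q_def K_def)
    then have r: "r \<in> radii p s" "r' \<in> radii p s"
      by simp_all
    have "s2\<^sup>2 > 1"
      using assms(5) by (metis one_less_power pos2 power2_abs)
    then have "K > 0"
      unfolding K_def using zero_le_power2 [of s1] by linarith
    \<comment> \<open>The two radii differ by 2 q / K, and q > 0.\<close>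
    then have ne: "r \<noteq> r'"
      using Q by (simp add: r_def r'_def q_def)
    note disj = fibre_disjoint [OF r ne n(1)]
    have "card (fibre n p s r \<union> fibre n p s r') = 4 * n"
      using card_Un_disjoint [OF fin [OF r(1)] fin [OF r(2)] disj] card_fibre r n(1) by simp
    then show "card (equilibria F) = 4 * n + 1"
      using zero_notin_fibre r n(1) fin by (simp add: F radii)
    show "\<forall>k::int. card (equilibria F \<inter> sector n k) = 2"
    proof
      fix k :: int
      obtain z z' where z: "fibre n p s r \<inter> sector n k = {z}" "fibre n p s r' \<inter> sector n k = {z'}"
        using fibre_sector [OF r(1) n(1)] fibre_sector [OF r(2) n(1)] by metis
      then have "z \<noteq> z'"
        using disj by blast
      moreover have "equilibria F \<inter> sector n k = {z, z'}"
        unfolding sector radii using z by auto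
      ultimately show "card (equilibria F \<inter> sector n k) = 2"
        by simp
    qed
  }
qed

end
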